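(* Let $t$, $p$, $q$ be primes such that $m = 2^{t}-1 = pq$. Then $m \in \mathbb{M}_{2}$.
   Context: For a product $m=pq$ of two distinct odd primes $p,q$: let $t_m$ be the multiplicative order of $2$ modulo $m$, and let $\gamma_m\in\mathbb{F}_{2^{t_m}}^{*}$ be a primitive $m$-th root of unity. The canonical set of $m$ is $S_m=\{s_{11},s_{01},s_{10}\}\subseteq\mathbb{Z}_m$, where $s_{\sigma_1\sigma_2}\in\mathbb{Z}_m$ is the unique residue with $s_{\sigma_1\sigma_2}\equiv\sigma_1 \pmod p$ and $s_{\sigma_1\sigma_2}\equiv\sigma_2\pmod q$ (so $s_{11}=1$). An $S_m$-decoding polynomial is a polynomial $P(X)\in\mathbb{F}_{2^{t_m}}[X]$ with $P(\gamma_m^{s})=0$ for all $s\in S_m$ and $P(1)=1$. $\mathbb{M}_2$ denotes the set of integers $m=pq$, with $p,q$ distinct odd primes, that yield a $3$-query (rather than $4$-query) linear locally decodable code in Efremenko's construction; concretely, $m\in\mathbb{M}_2$ means there exists an $S_m$-decoding polynomial with (at most, equivalently exactly) three monomials. *)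

theory Defs
  imports
    "HOL-Algebra.Algebraic_Closure_Type"
    "HOL-Library.Z2"
    "HOL-Number_Theory.Pocklington"
begin

text \<open>
  \<open>bit\<close> is the field with two elements, so \<open>bit alg_closure\<close> is an algebraic closure of it.
  The finite field of order \<open>2 ^ n\<close> is taken to be its unique copy there, i.e. the set of
  roots of \<open>X ^ (2 ^ n) - X\<close>.  Below it is checked that this set is a subfield with
  \<open>2 ^ n\<close> elements.
\<close>

definition GF2 :: "nat \<Rightarrow> bit alg_closure set" where
  "GF2 n = {x. x ^ (2 ^ n) = x}"

lemma CHAR_bit_alg_closure: "CHAR(bit alg_closure) = 2"
proof -
  have "CHAR(bit) = 2"
  proof (rule CHAR_eqI)
    fix n :: nat
    assume "of_nat n = (0 :: bit)"
    then have "even (of_nat n :: bit)" by (simp only: dvd_0_right)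
    then show "2 dvd n" by (simp only: even_of_nat_iff)
  qed simp
  then show ?thesis by simp
qed

lemma GF2_0: "0 \<in> GF2 n" and GF2_1: "1 \<in> GF2 n"
  by (simp_all add: GF2_def)

lemma GF2_add: "x \<in> GF2 n \<Longrightarrow> y \<in> GF2 n \<Longrightarrow> x + y \<in> GF2 n"
proof -
  assume a: "x \<in> GF2 n" "y \<in> GF2 n"
  have two: "(2 :: bit alg_closure) = 0"
    using of_nat_CHAR[where 'a = "bit alg_closure"] by (simp only: CHAR_bit_alg_closure of_nat_numeral)
  have "(u + v) ^ (2 ^ k) = u ^ (2 ^ k) + v ^ (2 ^ k)" for u v :: "bit alg_closure" and k
  proof (induction k)
    case (Suc k)
    have "(u + v) ^ (2 ^ Suc k) = ((u + v) ^ (2 ^ k)) ^ 2"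
      by (simp only: power_Suc2 power_mult)
    also have "\<dots> = (u ^ (2 ^ k)) ^ 2 + (v ^ (2 ^ k)) ^ 2"
      by (simp add: Suc power2_sum two)
    finally show ?case by (simp only: power_Suc2 power_mult)
  qed simp
  with a show ?thesis by (simp add: GF2_def)
qed

lemma GF2_mult: "x \<in> GF2 n \<Longrightarrow> y \<in> GF2 n \<Longrightarrow> x * y \<in> GF2 n"
  and GF2_inverse: "x \<in> GF2 n \<Longrightarrow> inverse x \<in> GF2 n"
  by (simp_all add: GF2_def power_mult_distrib power_inverse)

lemma GF2_uminus: "x \<in> GF2 n \<Longrightarrow> - x \<in> GF2 n"
  by (subst uminus_CHAR_2) (simp_all only: CHAR_bit_alg_closure)

lemma card_GF2:
  assumes "n > 0"
  shows "card (GF2 n) = 2 ^ n"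
proof -
  define f :: "bit alg_closure poly" where "f = monom 1 (2 ^ n) - monom 1 1"
  have gt: "(2::nat) ^ n > 1" using assms by (intro one_less_power) auto
  have deg: "degree f = 2 ^ n"
    unfolding f_def diff_conv_add_uminus
    using gt by (subst degree_add_eq_left) (simp_all add: degree_monom_eq)
  have [simp]: "f \<noteq> 0" using deg gt by auto
  have "of_nat (2 ^ n) = (0 :: bit alg_closure)"
    using assms by (simp only: of_nat_eq_0_iff_char_dvd CHAR_bit_alg_closure) simp
  then have der: "pderiv f = -1"
    by (simp add: f_def pderiv_diff pderiv_monom del: of_nat_power)
  obtain A where A: "size A = degree f" "f = smult (lead_coeff f) (\<Prod>x\<in>#A. [:-x, 1:])"
    using alg_closed_imp_factorization[OF \<open>f \<noteq> 0\<close>] by blast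
  have mult1: "count A x \<le> 1" for x
  proof (rule ccontr)
    assume "\<not> ?thesis"
    then have "x \<in># A" "x \<in># A - {#x#}" by (simp_all add: not_le flip: count_greater_zero_iff)
    then obtain B where B: "A = add_mset x (add_mset x B)"
      by (metis insert_DiffM)
    define g where "g = smult (lead_coeff f) (\<Prod>y\<in>#B. [:-y, 1:])"
    have "f = [:-x, 1:] * ([:-x, 1:] * g)"
      by (subst A(2)) (simp add: B g_def)
    moreover have "poly (pderiv ([:-x, 1:] * h)) x = poly h x" for h
      by (simp add: pderiv_mult pderiv_pCons del: mult_pCons_left)
    moreover have "poly ([:-x, 1:] * g) x = 0"
      by (simp del: mult_pCons_left)
    ultimately have "poly (pderiv f) x = 0" by simp
    with der show False by simp
  qed
  have roots: "set_mset A = {x. poly f x = 0}"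
  proof -
    have "poly f x = 0 \<longleftrightarrow> x \<in># A" for x
      by (subst A(2)) (auto simp: poly_prod_mset prod_mset_zero_iff)
    then show ?thesis by auto
  qed
  have "count A x = 1" if "x \<in># A" for x
    using mult1[of x] that count_greater_zero_iff[of A x] by linarith
  then have "size A = card (set_mset A)"
    by (simp add: size_multiset_overloaded_eq)
  moreover have "{x. poly f x = 0} = GF2 n"
    by (auto simp: f_def GF2_def poly_monom)
  ultimately show ?thesis using A(1) deg roots by simp
qed

definition primitive_root_of_unity :: "nat \<Rightarrow> 'a::field \<Rightarrow> bool" where
  "primitive_root_of_unity m g \<longleftrightarrow> g ^ m = 1 \<and> (\<forall>k. 0 < k \<and> k < m \<longrightarrow> g ^ k \<noteq> 1)"

definition crt_residue :: "nat \<Rightarrow> nat \<Rightarrow> nat \<Rightarrow> nat \<Rightarrow> nat" where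
  "crt_residue p q a b = (THE s. s < p * q \<and> [s = a] (mod p) \<and> [s = b] (mod q))"

text \<open>
  Residues modulo \<open>p * q\<close> are represented by natural numbers below \<open>p * q\<close>.
  The set is unchanged when \<open>p\<close> and \<open>q\<close> are swapped, so it depends on \<open>p * q\<close> only.
\<close>

definition canonical_set :: "nat \<Rightarrow> nat \<Rightarrow> nat set" where
  "canonical_set p q = {crt_residue p q 1 1, crt_residue p q 0 1, crt_residue p q 1 0}"

definition decoding_polynomial ::
  "nat \<Rightarrow> bit alg_closure \<Rightarrow> nat set \<Rightarrow> bit alg_closure poly \<Rightarrow> bool" where
  "decoding_polynomial n g S P \<longleftrightarrow>
     (\<forall>i. coeff P i \<in> GF2 n) \<and> (\<forall>s\<in>S. poly P (g ^ s) = 0) \<and> poly P 1 = 1"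

definition num_monomials :: "'a::zero poly \<Rightarrow> nat" where
  "num_monomials P = card {i. coeff P i \<noteq> 0}"

text \<open>
  \<open>ord m 2\<close> is the multiplicative order of 2 modulo \<open>m\<close>.  The choice of the primitive root of
  unity is immaterial, and one exists by \<open>ex_primitive_root_of_unity\<close> below, so the
  quantification over \<open>g\<close> is not vacuous.
\<close>

definition M2 :: "nat set" where
  "M2 = {m. \<exists>p q. prime p \<and> prime q \<and> odd p \<and> odd q \<and> p \<noteq> q \<and> m = p * q \<and>
     (\<forall>g \<in> GF2 (ord m 2). primitive_root_of_unity m g \<longrightarrow>
        (\<exists>P. decoding_polynomial (ord m 2) g (canonical_set p q) P \<and> num_monomials P = 3))}"

lemma crt_residue:
  assumes "prime p" "prime q" "p \<noteq> q"
  shows "crt_residue p q a b < p * q \<and>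
    [crt_residue p q a b = a] (mod p) \<and> [crt_residue p q a b = b] (mod q)"
  unfolding crt_residue_def
  by (rule theI'[OF binary_chinese_remainder_unique_nat])
    (use assms in \<open>auto simp: primes_coprime\<close>)

lemma crt_residue_1_1:
  assumes "prime p" "prime q" "p \<noteq> q"
  shows "crt_residue p q 1 1 = 1"
proof -
  have "1 < p * q" using assms by (metis less_1_mult prime_gt_1_nat)
  then show ?thesis
    using crt_residue[OF assms, of 1 1] assms
      binary_chinese_remainder_unique_nat[of p q 1 1]
    by (metis cong_refl not_prime_0 primes_coprime)
qed

lemma canonical_set_commute: "canonical_set p q = canonical_set q p"
proof -
  have "crt_residue p q a b = crt_residue q p b a" for a b
    unfolding crt_residue_def by (rule arg_cong[where f = The]) (auto simp: mult.commute)
  then show ?thesis by (auto simp: canonical_set_def)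
qed

lemma ex_root_of_unity:
  assumes "odd p" "prime p"
  shows "\<exists>g :: bit alg_closure. g ^ p = 1 \<and> g \<noteq> 1"
proof -
  have p1: "p > 1" using assms prime_gt_1_nat by blast
  have "\<exists>x :: bit alg_closure. (\<Sum>k\<le>p - 1. 1 * x ^ k) = 0"
    by (rule alg_closed) (use p1 in auto)
  then obtain x :: "bit alg_closure" where x: "(\<Sum>k\<le>p - 1. x ^ k) = 0" by auto
  have "{..p - 1} = {..<p}" using p1 by auto
  with x have x: "(\<Sum>k<p. x ^ k) = 0" by simp
  have "x \<noteq> 1"
  proof
    assume "x = 1"
    with x have "of_nat p = (0 :: bit alg_closure)" by simp
    then show False using assms
      by (simp only: of_nat_eq_0_iff_char_dvd CHAR_bit_alg_closure)
  qed
  moreover have "x ^ p - 1 = (x - 1) * (\<Sum>k<p. x ^ k)" by (rule power_diff_1_eq)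
  ultimately show ?thesis using x by auto
qed

lemma power_eq_1_prime_dvd:
  fixes g :: "'a::field"
  assumes "prime p" "g ^ p = 1" "g \<noteq> 1" "g ^ k = 1"
  shows "p dvd k"
proof (rule ccontr)
  assume "\<not> p dvd k"
  then have "coprime k p" using assms(1) by (meson coprime_commute prime_imp_coprime)
  then obtain a b where "k * a = p * b + 1"
    using coprime_bezout_strong[of k p] assms(1) not_prime_1 by blast
  then have "g ^ (k * a) = g ^ (p * b + 1)" by simp
  then show False using assms by (simp add: power_mult)
qed

lemma ex_primitive_root_of_unity:
  assumes "prime p" "prime q" "odd p" "odd q" "p \<noteq> q"
  shows "\<exists>g \<in> GF2 (ord (p * q) 2). primitive_root_of_unity (p * q) g"
proof -
  obtain x :: "bit alg_closure" where x: "x ^ p = 1" "x \<noteq> 1"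
    using ex_root_of_unity assms by blast
  obtain y :: "bit alg_closure" where y: "y ^ q = 1" "y \<noteq> 1"
    using ex_root_of_unity assms by blast
  define g where "g = x * y"
  have g: "g ^ (p * q) = 1"
    using x y by (simp add: g_def power_mult_distrib power_mult) (metis mult.commute power_mult power_one)
  have cop: "coprime p q" using assms by (simp add: primes_coprime)
  have dvd: "p * q dvd k" if "g ^ k = 1" for k
  proof -
    have "x ^ (k * q) = g ^ (k * q)" "y ^ (k * p) = g ^ (k * p)"
      using x y by (simp_all add: g_def power_mult_distrib mult.commute[of k] power_mult)
    with that have "x ^ (k * q) = 1" "y ^ (k * p) = 1" by (simp_all add: power_mult)
    then have "p dvd k * q" "q dvd k * p"
      using power_eq_1_prime_dvd x y assms by blast+
    with cop have "p dvd k" "q dvd k"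
      by (simp_all add: coprime_dvd_mult_left_iff coprime_commute)
    with cop show ?thesis by (simp add: divides_mult)
  qed
  have "coprime (p * q) 2" using assms by (simp add: coprime_right_2_iff_odd)
  then have "[2 ^ ord (p * q) 2 = 1] (mod (p * q))" using ord by blast
  then have "p * q dvd 2 ^ ord (p * q) 2 - 1"
    using cong_to_1_nat by blast
  then obtain c where "2 ^ ord (p * q) 2 - 1 = p * q * c" by blast
  then have "2 ^ ord (p * q) 2 = p * q * c + 1"
    by (metis add.commute le_add_diff_inverse one_le_numeral one_le_power)
  then have "g \<in> GF2 (ord (p * q) 2)" using g by (simp add: GF2_def power_mult)
  moreover have "primitive_root_of_unity (p * q) g"
    unfolding primitive_root_of_unity_def using g dvd nat_dvd_not_less by blast
  ultimately show ?thesis by blast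
qed

end

theory Submission
  imports Defs
begin

text \<open>
  Let \<open>U\<close> and \<open>V\<close> be the groups of \<open>q\<close>-th and \<open>p\<close>-th roots of unity, so that \<open>U V\<close> is the whole
  multiplicative group of the field with \<open>2 ^ t\<close> elements.  If
  \<open>(1 - u1) (1 - v2) = (1 - u2) (1 - v1)\<close> for distinct \<open>u1\<close>, \<open>u2\<close> in \<open>U - {1}\<close> and distinct
  \<open>v1\<close>, \<open>v2\<close> in \<open>V - {1}\<close>, then the three points at which a trinomial has to vanish impose
  dependent linear conditions on its coefficients, and a decoding trinomial exists.
  Otherwise, since \<open>1 - v = (1 - v\<^sup>2) / (1 - v)\<close> in characteristic 2, the sets
  \<open>{1} \<union> (1 - (V - {1}))\<close> and \<open>{1} \<union> (1 - (U - {1}))\<^sup>-\<^sup>1\<close>, of sizes \<open>p\<close> and \<open>q\<close>, form a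
  factorization of the cyclic group of order \<open>p q\<close>.  As in the theorem of Hajos, one of the two
  factors is a subgroup, hence \<open>1 - (V - {1}) \<subseteq> V\<close> (or the same for \<open>U\<close>), and \<open>V \<union> {0}\<close> is a
  proper subfield with more than two elements, which does not exist for prime \<open>t\<close>.
\<close>

subsection \<open>Factorizations of finite cyclic groups\<close>

text \<open>Members of \<open>A\<close> and \<open>B\<close> need not lie below \<open>m\<close>, so
  that scaling \<open>A\<close> by a positive number involves no reduction and visibly keeps
  \<open>card A\<close>.\<close>

definition factorization_mod :: "nat \<Rightarrow> nat set \<Rightarrow> nat set \<Rightarrow> bool" where
  "factorization_mod m A B \<longleftrightarrow> bij_betw (\<lambda>(a, b). (a + b) mod m) (A \<times> B) {..<m}"

text \<open>A prime \<open>l\<close> divides the inner binomial coefficients of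
  \<open>(u + v) ^ l\<close>; summands are added one at a time. The ring of use is that of integer
  polynomials.\<close>

lemma prime_dvd_sum_power_diff:
  fixes f :: "'b \<Rightarrow> 'a::comm_ring_1"
  assumes "prime l" "finite A"
  shows "of_nat l dvd (\<Sum>a\<in>A. f a) ^ l - (\<Sum>a\<in>A. f a ^ l)"
  using assms(2)
proof (induction A rule: finite_induct)
  case empty
  then show ?case using assms(1) by (simp add: prime_gt_0_nat zero_power)
next
  case (insert x A)
  have l: "l > 0" using assms(1) by (simp add: prime_gt_0_nat)
  have add: "of_nat l dvd (u + v) ^ l - (u ^ l + v ^ l)" for u v :: 'a
  proof -
    have "(u + v) ^ l = (\<Sum>k\<le>l. of_nat (l choose k) * u ^ k * v ^ (l - k))"
      by (rule binomial_ring)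
    also have "{..l} = insert 0 (insert l {0<..<l})" using l by auto
    also have "(\<Sum>k\<in>\<dots>. of_nat (l choose k) * u ^ k * v ^ (l - k)) =
        v ^ l + (u ^ l + (\<Sum>k\<in>{0<..<l}. of_nat (l choose k) * u ^ k * v ^ (l - k)))"
      using l by simp
    finally have "(u + v) ^ l - (u ^ l + v ^ l) =
        (\<Sum>k\<in>{0<..<l}. of_nat (l choose k) * u ^ k * v ^ (l - k))" by simp
    moreover have "of_nat l dvd (of_nat (l choose k) * u ^ k * v ^ (l - k))" if "k \<in> {0<..<l}" for k
    proof -
      have "l dvd (l choose k)" using that assms(1) l by (intro dvd_choose_prime) auto
      then show ?thesis by (auto elim!: dvdE simp: mult.assoc)
    qed
    ultimately show ?thesis by (metis (no_types, lifting) dvd_sum)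
  qed
  have "(\<Sum>a\<in>insert x A. f a) ^ l - (\<Sum>a\<in>insert x A. f a ^ l) =
     ((f x + (\<Sum>a\<in>A. f a)) ^ l - (f x ^ l + (\<Sum>a\<in>A. f a) ^ l)) +
     ((\<Sum>a\<in>A. f a) ^ l - (\<Sum>a\<in>A. f a ^ l))"
    using insert by simp
  with add insert.IH show ?case by (metis dvd_add)
qed

lemma factorization_mod_unique:
  assumes "factorization_mod m A B" "a \<in> A" "a' \<in> A" "b \<in> B" "b' \<in> B"
    and "(a + b) mod m = (a' + b') mod m"
  shows "a = a'" "b = b'"
  using assms inj_onD[of "\<lambda>(a, b). (a + b) mod m" "A \<times> B" "(a, b)" "(a', b')"]
  unfolding factorization_mod_def bij_betw_def by auto

lemma factorization_mod_exists:
  assumes "factorization_mod m A B" "r < m"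
  obtains a b where "a \<in> A" "b \<in> B" "(a + b) mod m = r"
proof -
  have "r \<in> (\<lambda>(a, b). (a + b) mod m) ` (A \<times> B)"
    using assms unfolding factorization_mod_def bij_betw_def by simp
  then show ?thesis using that by auto
qed

lemma factorization_mod_card:
  assumes "factorization_mod m A B"
  shows "card A * card B = m"
  using bij_betw_same_card[OF assms[unfolded factorization_mod_def]]
  by (simp add: card_cartesian_product)

lemma factorization_mod_finite:
  assumes "factorization_mod m A B" "m > 0"
  shows "finite A" "finite B"
  using factorization_mod_card[OF assms(1)] assms(2) by (auto intro!: card_ge_0_finite)

lemma factorization_mod_shift:
  assumes "factorization_mod m A B" "r < m"
  shows "card {(a, b) \<in> A \<times> B. (n + a + b) mod m = r} = 1"
proof -
  \<comment> \<open>Adding \<open>m * n\<close> keeps the natural subtraction of \<open>n\<close>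
    from truncating at 0.\<close>
  define r' where "r' = (m * n + r - n) mod m"
  have "r' < m" using assms(2) by (simp add: r'_def)
  have "(n + x) mod m = r \<longleftrightarrow> x mod m = r'" for x
  proof -
    have n: "n \<le> m * n + r" using assms(2) by (cases m) auto
    have "(n + x) mod m = r \<longleftrightarrow> [n + x = r] (mod m)"
      using assms(2) by (simp add: cong_def)
    also have "\<dots> \<longleftrightarrow> [n + x = n + (m * n + r - n)] (mod m)"
      using n by (simp add: cong_def)
    also have "\<dots> \<longleftrightarrow> [x = m * n + r - n] (mod m)"
      by (rule cong_add_lcancel_nat)
    finally show ?thesis by (simp add: cong_def r'_def)
  qed
  then have "{(a, b) \<in> A \<times> B. (n + a + b) mod m = r} = {(a, b) \<in> A \<times> B. (a + b) mod m = r'}"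
    by (simp add: add.assoc)
  also obtain a b where ab: "a \<in> A" "b \<in> B" "(a + b) mod m = r'"
    using factorization_mod_exists[OF assms(1) \<open>r' < m\<close>] .
  have "{(a, b) \<in> A \<times> B. (a + b) mod m = r'} = {(a, b)}"
    using ab factorization_mod_unique[OF assms(1)] by fastforce
  finally show ?thesis by simp
qed

text \<open>
  In the group ring modulo \<open>l\<close>, the \<open>l\<close>-th power of the sum over \<open>A\<close> is the sum over the \<open>l\<close>-fold
  elements of \<open>A\<close>.  Hence modulo \<open>l\<close> each residue has \<open>card A ^ (l - 1)\<close> representations
  \<open>l a + b\<close>, and so at least one.
\<close>

lemma factorization_mod_mult_prime:
  assumes fac: "factorization_mod m A B" and "m > 0" and l: "prime l" "\<not> l dvd card A"
  shows "factorization_mod m ((\<lambda>a. l * a) ` A) B"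
proof -
  have fin: "finite A" "finite B" using factorization_mod_finite assms by auto
  have l0: "l > 0" using l by (simp add: prime_gt_0_nat)
  define g :: "nat \<times> nat \<Rightarrow> nat" where "g = (\<lambda>(a, b). (l * a + b) mod m)"
  have ex: "\<exists>x\<in>A \<times> B. g x = r" if "r < m" for r
  proof -
    define f :: "int poly" where "f = (\<Sum>a\<in>A. monom 1 a)"
    define G :: "int poly" where "G = (\<Sum>b\<in>B. monom 1 b)"
    \<comment> \<open>The split \<open>f ^ l * G = (f * G) * h\<close> exploits the factorization:
      each monomial of \<open>h\<close>, multiplied by \<open>f * G\<close>, meets the class of
      \<open>r\<close> exactly once, so this class collects \<open>poly h 1\<close>, a power of
      \<open>card A\<close>.\<close>
    define h where "h = f ^ (l - 1)"
    obtain k where k: "f ^ l - (\<Sum>a\<in>A. monom 1 a ^ l) = of_nat l * k"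
      using prime_dvd_sum_power_diff[OF l(1) fin(1), of "monom (1::int)"]
      unfolding f_def by blast
    obtain N where N: "\<And>a b n. a \<in> A \<Longrightarrow> b \<in> B \<Longrightarrow> n \<le> degree h \<Longrightarrow> n + a + b \<le> N"
      "\<And>a b. a \<in> A \<Longrightarrow> b \<in> B \<Longrightarrow> l * a + b \<le> N"
    proof
      fix a b n assume "a \<in> A" "b \<in> B" "n \<le> degree h"
      then have "a \<le> \<Sum>A" "b \<le> \<Sum>B" using fin by (auto intro: member_le_sum)
      then show "n + a + b \<le> degree h + l * \<Sum>A + \<Sum>B"
        using \<open>n \<le> degree h\<close> l0 by (intro add_mono) (auto intro: order.trans)
    next
      fix a b assume "a \<in> A" "b \<in> B"
      then have "a \<le> \<Sum>A" "b \<le> \<Sum>B" using fin by (auto intro: member_le_sum)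
      then show "l * a + b \<le> degree h + l * \<Sum>A + \<Sum>B"
        by (simp add: add_mono trans_le_add2 add.assoc)
    qed
    \<comment> \<open>the coefficient of \<open>r\<close> in the group ring, for polynomials of degree at most \<open>N\<close>\<close>
    define L where "L = (\<lambda>f::int poly. \<Sum>i | i \<le> N \<and> i mod m = r. coeff f i)"
    have L_sum: "L (\<Sum>i\<in>I. \<phi> i) = (\<Sum>i\<in>I. L (\<phi> i))" for I :: "'c set" and \<phi>
      unfolding L_def coeff_sum by (rule sum.swap)
    have L_monom: "L (monom c n) = (if n mod m = r then c else 0)" if "n \<le> N" for c n
    proof -
      have "finite {i. i \<le> N \<and> i mod m = r}" by simp
      then show ?thesis using that unfolding L_def by (simp add: coeff_monom)
    qed
    have fG: "f * G = (\<Sum>(a, b)\<in>A \<times> B. monom 1 (a + b))"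
      by (simp add: f_def G_def sum_product sum.cartesian_product mult_monom)
    have h: "h = (\<Sum>n\<le>degree h. monom (coeff h n) n)" by (rule poly_as_sum_of_monoms[symmetric])
    have "f ^ l * G = (f * G) * h"
      using l0 by (simp add: h_def power_eq_if mult_ac)
    also have "\<dots> = (\<Sum>n\<le>degree h. \<Sum>(a, b)\<in>A \<times> B. monom (coeff h n) (n + a + b))"
      by (subst h, subst sum_distrib_left)
        (simp add: fG sum_distrib_right mult_monom case_prod_unfold add_ac)
    also have "L \<dots> = (\<Sum>n\<le>degree h. \<Sum>x\<in>A \<times> B. L (case x of (a, b) \<Rightarrow> monom (coeff h n) (n + a + b)))"
      by (simp only: L_sum)
    also have "\<dots> = (\<Sum>n\<le>degree h. \<Sum>(a, b)\<in>A \<times> B. if (n + a + b) mod m = r then coeff h n else 0)"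
      by (intro sum.cong refl) (auto simp: L_monom N)
    also have "\<dots> = (\<Sum>n\<le>degree h. coeff h n * int (card {(a, b) \<in> A \<times> B. (n + a + b) mod m = r}))"
    proof (intro sum.cong refl)
      fix n
      have "(\<Sum>(a, b)\<in>A \<times> B. if (n + a + b) mod m = r then coeff h n else 0) =
          (\<Sum>x\<in>A \<times> B. if x \<in> {(a, b). (n + a + b) mod m = r} then coeff h n else 0)"
        by (intro sum.cong) auto
      also have "\<dots> = (\<Sum>x\<in>A \<times> B \<inter> {(a, b). (n + a + b) mod m = r}. coeff h n)"
        using fin by (intro sum.inter_restrict[symmetric]) auto
      also have "A \<times> B \<inter> {(a, b). (n + a + b) mod m = r} = {(a, b) \<in> A \<times> B. (n + a + b) mod m = r}"
        by auto
      finally show "(\<Sum>(a, b)\<in>A \<times> B. if (n + a + b) mod m = r then coeff h n else 0) =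
          coeff h n * int (card {(a, b) \<in> A \<times> B. (n + a + b) mod m = r})"
        by simp
    qed
    also have "\<dots> = poly h 1"
      using factorization_mod_shift[OF fac that] by (simp add: poly_altdef)
    also have "\<dots> = int (card A) ^ (l - 1)"
      by (simp add: h_def f_def poly_sum poly_monom)
    finally have L1: "L (f ^ l * G) = int (card A) ^ (l - 1)" .
    \<comment> \<open>\<open>L\<close> is linear and integer-valued, so replacing
      \<open>f ^ l\<close> by the sum of \<open>l\<close>-th powers changes the value only by a
      multiple of \<open>l\<close>.\<close>
    have "L (f ^ l * G) = L ((\<Sum>a\<in>A. monom 1 a ^ l) * G + of_nat l * (k * G))"
      using k by (simp add: algebra_simps)
    also have "\<dots> = L ((\<Sum>a\<in>A. monom 1 a ^ l) * G) + int l * L (k * G)"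
      by (simp add: L_def sum.distrib sum_distrib_left of_nat_poly)
    finally have L2: "L (f ^ l * G) = L ((\<Sum>a\<in>A. monom 1 a ^ l) * G) + int l * L (k * G)" .
    have "\<not> int l dvd L (f ^ l * G)"
      using l prime_dvd_power[of "int l" "int (card A)" "l - 1"]
      unfolding L1 by (auto simp flip: of_nat_power)
    then have "L ((\<Sum>a\<in>A. monom 1 a ^ l) * G) \<noteq> 0" using L2 by auto
    moreover have "(\<Sum>a\<in>A. monom 1 a ^ l) * G = (\<Sum>(a, b)\<in>A \<times> B. monom 1 (l * a + b))"
      by (simp add: G_def sum_product sum.cartesian_product mult_monom monom_power mult.commute[of _ l])
    ultimately have "(\<Sum>x\<in>A \<times> B. L (case x of (a, b) \<Rightarrow> monom 1 (l * a + b))) \<noteq> 0"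
      by (simp only: L_sum not_False_eq_True)
    then obtain x where x: "x \<in> A \<times> B" "L (case x of (a, b) \<Rightarrow> monom 1 (l * a + b)) \<noteq> 0"
      by (meson sum.neutral)
    then show ?thesis
      by (intro bexI[of _ x]) (auto simp: L_monom N g_def split: if_splits)
  qed
  \<comment> \<open>Both sides have \<open>card A * card B = m\<close> elements, so this
    surjectivity yields injectivity.\<close>
  have "g ` (A \<times> B) = {..<m}"
    using ex \<open>m > 0\<close> by (force simp: g_def)
  moreover from this have "inj_on g (A \<times> B)"
    using fin factorization_mod_card[OF fac]
    by (intro eq_card_imp_inj_on) (auto simp: card_cartesian_product)
  ultimately have "bij_betw g (A \<times> B) {..<m}" by (simp add: bij_betw_def)
  moreover have "bij_betw (\<lambda>(a, b). (l * a, b)) (A \<times> B) ((\<lambda>a. l * a) ` A \<times> B)"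
    using l0 by (auto simp: bij_betw_def inj_on_def)
  ultimately show ?thesis
    unfolding factorization_mod_def
    by (subst bij_betw_comp_iff) (auto simp: g_def comp_def case_prod_unfold)
qed

text \<open>The prime factors of \<open>k\<close> are applied one after another; none of them
  divides \<open>card A\<close>, which scaling leaves fixed.\<close>

lemma factorization_mod_mult:
  assumes "factorization_mod m A B" "m > 0" "coprime k (card A)" "k > 0"
  shows "factorization_mod m ((\<lambda>a. k * a) ` A) B"
  using assms
proof (induction k arbitrary: A rule: prime_divisors_induct)
  case (factor l k)
  have l0: "l > 0" "k > 0" using factor by auto
  have "\<not> l dvd card A"
    using factor.hyps factor.prems(3) by (metis coprime_common_divisor dvd_triv_left not_prime_unit)
  then have 1: "factorization_mod m ((\<lambda>a. l * a) ` A) B"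
    using factor by (intro factorization_mod_mult_prime)
  have "card ((\<lambda>a. l * a) ` A) = card A"
    using l0 by (intro card_image) (auto simp: inj_on_def)
  then have "factorization_mod m ((\<lambda>a. k * a) ` (\<lambda>a. l * a) ` A) B"
    using factor.prems l0 by (intro factor.IH[OF 1]) auto
  then show ?case by (simp add: image_image mult_ac)
qed auto

text \<open>Scaling by \<open>q\<close>, which is prime to \<open>card A\<close>, turns congruence
  mod \<open>p\<close> into congruence mod \<open>p * q\<close>, where the scaled factorization
  separates distinct elements.\<close>

lemma factorization_mod_cong_imp_eq:
  assumes "factorization_mod (p * q) A B" "prime p" "prime q" "p \<noteq> q" "card A = p" "card B = q"
    and "a \<in> A" "a' \<in> A" "[a = a'] (mod p)"
  shows "a = a'"
proof -
  have pos: "p > 0" "q > 0" using assms by (auto simp: prime_gt_0_nat)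
  have "coprime q p" using assms by (simp add: primes_coprime)
  then have *: "factorization_mod (p * q) ((\<lambda>a. q * a) ` A) B"
    using assms pos by (intro factorization_mod_mult) auto
  obtain b where b: "b \<in> B" using assms pos by fastforce
  have "[q * a = q * a'] (mod p * q)"
    using assms(9) by (metis cong_cmult_leftI mult.commute)
  then have "(q * a + b) mod (p * q) = (q * a' + b) mod (p * q)"
    by (metis cong_add cong_def cong_refl)
  then have "q * a = q * a'"
    using factorization_mod_unique(1)[OF *, of "q * a" "q * a'" b b] assms(7,8) b by blast
  then show ?thesis using pos by simp
qed

text \<open>
  If \<open>a - a'\<close> and \<open>b' - b\<close> are not divisible by \<open>q\<close> and \<open>p\<close>, respectively, some \<open>k\<close> prime to \<open>p\<close>
  satisfies \<open>k (a - a') = b' - b\<close>, so that \<open>k A + B\<close> is not direct.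
\<close>

lemma factorization_mod_prime_prime:
  assumes fac: "factorization_mod (p * q) A B"
    and pq: "prime p" "prime q" "p \<noteq> q" "card A = p" "card B = q"
  shows "(\<forall>a\<in>A. \<forall>a'\<in>A. [a = a'] (mod q)) \<or> (\<forall>b\<in>B. \<forall>b'\<in>B. [b = b'] (mod p))"
proof (rule ccontr)
  assume "\<not> ?thesis"
  then obtain a a' b b' where ab: "a \<in> A" "a' \<in> A" "b \<in> B" "b' \<in> B"
    and aq: "\<not> [a = a'] (mod q)" and bp: "\<not> [b = b'] (mod p)" by blast
  define m where "m = p * q"
  have m0: "m > 0" using pq by (auto simp: m_def prime_gt_0_nat)
  \<comment> \<open>Incongruent mod \<open>q\<close> means distinct, hence incongruent mod
    \<open>p\<close> too; this makes the difference \<open>d\<close> invertible mod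
    \<open>m\<close>.\<close>
  have ap: "\<not> [a = a'] (mod p)"
    using factorization_mod_cong_imp_eq[OF fac pq ab(1,2)] aq by auto
  define d where "d = int a - int a'"
  define e where "e = int b' - int b"
  have "\<not> int p dvd d" "\<not> int q dvd d" and ep: "\<not> int p dvd e"
    using ap aq bp cong_sym[of b' b p]
    by (auto simp: d_def e_def simp flip: cong_int_iff cong_iff_dvd_diff)
  then have "coprime d (int p)" "coprime d (int q)"
    using pq prime_imp_coprime[of "int p" d] prime_imp_coprime[of "int q" d]
    by (auto simp: coprime_commute)
  then have "coprime d (int m)" by (simp add: m_def)
  then obtain c where c: "[d * c = 1] (mod int m)" using cong_solve_coprime_int by blast
  define k where "k = nat ((c * e) mod int m)"
  have k: "int k = (c * e) mod int m" using m0 by (simp add: k_def)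
  have "[int k = c * e] (mod int m)" by (simp add: k)
  then have "[d * int k = d * (c * e)] (mod int m)" by (rule cong_scalar_left)
  also have "d * (c * e) = (d * c) * e" by simp
  also have "[(d * c) * e = 1 * e] (mod int m)" using c by (rule cong_scalar_right)
  finally have dk: "[d * int k = e] (mod int m)" by simp
  have kp: "\<not> p dvd k"
  proof
    assume "p dvd k"
    then have "int p dvd d * int k" by simp
    moreover have "[d * int k = e] (mod int p)"
      using dk by (rule cong_dvd_modulus) (simp add: m_def)
    ultimately show False using ep cong_dvd_iff by blast
  qed
  then have "k > 0" by (cases k) auto
  moreover have "coprime k (card A)" using kp pq prime_imp_coprime coprime_commute by metis
  ultimately have *: "factorization_mod m ((\<lambda>a. k * a) ` A) B"
    using fac m0 by (intro factorization_mod_mult) (auto simp: m_def)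
  have "int (k * a + b) - int (k * a' + b') = d * int k - e"
    by (simp add: d_def e_def algebra_simps)
  with dk have "[int (k * a + b) = int (k * a' + b')] (mod int m)"
    by (simp add: cong_iff_dvd_diff)
  then have "(k * a + b) mod m = (k * a' + b') mod m"
    by (simp only: cong_int_iff) (simp add: cong_def)
  then have "b = b'"
    using factorization_mod_unique(2)[OF *, of "k * a" "k * a'" b b'] ab by blast
  then show False using bp by auto
qed

subsection \<open>Roots of unity\<close>

lemma primitive_root_power_eq_1_iff:
  assumes "primitive_root_of_unity n g" "n > 0"
  shows "g ^ i = 1 \<longleftrightarrow> n dvd i"
proof -
  have g: "g ^ n = 1" "\<And>k. 0 < k \<Longrightarrow> k < n \<Longrightarrow> g ^ k \<noteq> 1"
    using assms(1) by (auto simp: primitive_root_of_unity_def)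
  have "g ^ i = g ^ (n * (i div n) + i mod n)" by simp
  also have "\<dots> = g ^ (i mod n)" by (simp only: power_add power_mult g power_one mult_1_left)
  finally have "g ^ i = g ^ (i mod n)" .
  then show ?thesis
    using g(2)[of "i mod n"] assms(2) by (auto simp: dvd_eq_mod_eq_0)
qed

lemma primitive_root_power_eq_iff:
  assumes "primitive_root_of_unity n g" "n > 0"
  shows "g ^ i = g ^ j \<longleftrightarrow> [i = j] (mod n)"
proof -
  have "g \<noteq> 0"
    using assms by (auto simp: primitive_root_of_unity_def power_0_left)
  have le: "g ^ i = g ^ j \<longleftrightarrow> [i = j] (mod n)" if "i \<le> j" for i j
  proof -
    have "g ^ j = g ^ i * g ^ (j - i)" using that by (simp flip: power_add)
    then have "g ^ i = g ^ j \<longleftrightarrow> g ^ (j - i) = 1" using \<open>g \<noteq> 0\<close> by auto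
    also have "\<dots> \<longleftrightarrow> [i = j] (mod n)"
      using primitive_root_power_eq_1_iff[OF assms] that
      by (metis cong_altdef_nat cong_sym_eq)
    finally show ?thesis .
  qed
  show ?thesis using le[of i j] le[of j i] cong_sym_eq[of i j n] by (cases i j rule: linorder_cases) auto
qed

text \<open>The \<open>n\<close> powers are distinct, and \<open>X ^ n - 1\<close> has at most
  \<open>n\<close> roots.\<close>

lemma bij_betw_power_primitive_root:
  assumes "primitive_root_of_unity n g" "n > 0"
  shows "bij_betw (\<lambda>i. g ^ i) {..<n} {x. x ^ n = 1}"
proof -
  have inj: "inj_on (\<lambda>i. g ^ i) {..<n}"
    using assms by (auto simp: inj_on_def primitive_root_power_eq_iff cong_def)
  define f :: "'a poly" where "f = monom 1 n + [:- 1:]"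
  have deg: "degree f = n"
    unfolding f_def using assms(2) by (subst degree_add_eq_left) (simp_all add: degree_monom_eq)
  then have "f \<noteq> 0" using assms(2) by auto
  moreover have "{x. poly f x = 0} = {x. x ^ n = 1}" by (auto simp: f_def poly_monom)
  ultimately have fin: "finite {x :: 'a. x ^ n = 1}" and card: "card {x :: 'a. x ^ n = 1} \<le> n"
    using poly_roots_finite[of f] card_poly_roots_bound[of f] deg by simp_all
  have "g ^ n = 1" using assms(1) by (simp add: primitive_root_of_unity_def)
  then have "(g ^ i) ^ n = 1" for i by (metis mult.commute power_mult power_one)
  then have sub: "(\<lambda>i. g ^ i) ` {..<n} \<subseteq> {x. x ^ n = 1}" by auto
  have "card {x :: 'a. x ^ n = 1} \<le> card ((\<lambda>i. g ^ i) ` {..<n})"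
    using card by (simp add: card_image[OF inj])
  then have "(\<lambda>i. g ^ i) ` {..<n} = {x. x ^ n = 1}"
    using fin sub by (intro card_subset_eq) (auto intro!: antisym card_mono)
  with inj show ?thesis by (simp add: bij_betw_def)
qed

lemma primitive_root_of_unity_power:
  assumes "primitive_root_of_unity (p * q) g" "p > 0" "q > 0"
  shows "primitive_root_of_unity p (g ^ q)"
  unfolding primitive_root_of_unity_def
  using assms primitive_root_power_eq_1_iff[OF assms(1)]
  by (auto simp: nat_dvd_not_less mult.commute simp flip: power_mult)

text \<open>The quotient \<open>u / u' = w' / w\<close> lies in two groups of coprime orders, so it
  is 1.\<close>

lemma roots_of_unity_decompose_unique:
  fixes u u' w w' :: "'a :: field"
  assumes "prime p" "prime q" "p \<noteq> q" "u ^ q = 1" "u' ^ q = 1" "w ^ p = 1" "w' ^ p = 1"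
    and "u * w = u' * w'"
  shows "u = u'" "w = w'"
proof -
  have nz: "u \<noteq> 0" "u' \<noteq> 0" "w \<noteq> 0" "w' \<noteq> 0"
    using assms by (auto simp: power_0_left prime_gt_0_nat split: if_splits)
  have eq: "u / u' = w' / w" using assms(8) nz by (simp add: field_simps)
  have "(u / u') ^ q = 1" using assms by (simp add: power_divide)
  moreover have "(u / u') ^ p = 1" unfolding eq using assms by (simp add: power_divide)
  ultimately have "u / u' = 1"
    using power_eq_1_prime_dvd[of p "u / u'" q] assms by (metis primes_dvd_imp_eq)
  then show "u = u'" "w = w'" using eq nz by auto
qed

text \<open>\<open>(u z - v w, v - z, w - u)\<close> is the cross product of
  \<open>(1, u, v)\<close> and \<open>(1, w, z)\<close>. \<open>det\<close> is its product with
  \<open>(1, u w, v z)\<close>, the conclusion its product with \<open>(1, 1, 1)\<close>. If both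
  vanished, \<open>(u, v)\<close>, \<open>(w, z)\<close> and \<open>(u w, v z)\<close> would lie on
  one line through \<open>(1, 1)\<close>, of slope \<open>k\<close>, which forces \<open>k\<close>
  to be 0 or 1.\<close>

lemma collinear_kernel_sum_nonzero:
  fixes u v w z :: "'a :: field"
  assumes "u \<noteq> 1" "v \<noteq> 1" "w \<noteq> 1" "u \<noteq> v" "v \<noteq> z" "u \<noteq> w"
    and det: "(u * z - v * w) + (v - z) * (u * w) + (w - u) * (v * z) = 0"
  shows "(u * z - v * w) + (v - z) + (w - u) \<noteq> 0"
proof
  assume S: "(u * z - v * w) + (v - z) + (w - u) = 0"
  define k where "k = (1 - v) / (1 - u)"
  have v: "1 - v = k * (1 - u)" using assms(1) by (simp add: k_def)
  have "(1 - v) * (1 - w) = (1 - u) * (1 - z)" using S by (simp add: algebra_simps)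
  then have "(1 - u) * (1 - z) = (1 - u) * (k * (1 - w))" by (simp only: v mult_ac)
  then have z: "1 - z = k * (1 - w)" using assms(1) by (subst (asm) mult_left_cancel) auto
  \<comment> \<open>Subtracting the two determinants puts \<open>(u w, v z)\<close> on the line
    through \<open>(1, 1)\<close> in the direction of \<open>(w - u, z - v)\<close>, which has slope
    \<open>k\<close>.\<close>
  have "(v - z) * (1 - u * w) + (w - u) * (1 - v * z) =
      ((u * z - v * w) + (v - z) + (w - u)) -
      ((u * z - v * w) + (v - z) * (u * w) + (w - u) * (v * z))"
    by (simp add: algebra_simps)
  then have "(v - z) * (1 - u * w) + (w - u) * (1 - v * z) = 0" by (simp only: S det diff_self)
  moreover have vz: "v - z = - k * (w - u)"
  proof -
    have "v - z = (1 - z) - (1 - v)" by simp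
    also have "\<dots> = - k * (w - u)" by (simp only: v z) (simp add: algebra_simps)
    finally show ?thesis .
  qed
  ultimately have "(w - u) * ((1 - v * z) - k * (1 - u * w)) = 0"
    by (simp only: vz) (simp add: algebra_simps)
  then have eq: "(1 - v * z) - k * (1 - u * w) = 0" using assms(6) by simp
  have v': "v = 1 - k * (1 - u)" and z': "z = 1 - k * (1 - w)" using v z by (simp_all add: algebra_simps)
  have "(1 - v * z) - k * (1 - u * w) = k * (1 - k) * ((1 - u) * (1 - w))"
    by (simp only: v' z') (simp add: algebra_simps)
  moreover have "k \<noteq> 0" "k \<noteq> 1" using assms v by auto
  ultimately show False using assms eq by simp
qed

lemma GF2_iff:
  assumes "n = 2 ^ t - 1"
  shows "x \<in> GF2 t \<longleftrightarrow> x = 0 \<or> x ^ n = 1"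
proof -
  have "x ^ (2 ^ t) = x ^ (n + 1)" unfolding assms by (rule arg_cong[where f = "\<lambda>k. x ^ k"]) simp
  then show ?thesis by (auto simp: GF2_def)
qed

subsection \<open>Decoding trinomials\<close>

text \<open>With \<open>g ^ i = u w\<close> and \<open>g ^ j = v z\<close>, the monomials
  \<open>1, X^i, X^j\<close> take the values \<open>(1, u w, v z)\<close>, \<open>(1, u, v)\<close>
  and \<open>(1, w, z)\<close> at the three points. The cross product of the last two rows gives the
  coefficients, and the collision makes it orthogonal to the first as well. Dividing by
  \<open>s\<close> makes the value at 1 equal to 1.\<close>

lemma collision_imp_decoding_polynomial:
  fixes u1 u2 v1 v2 g :: "bit alg_closure"
  assumes pq: "prime p" "prime q" "p \<noteq> q" and m: "p * q = 2 ^ t - 1"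
    and g: "primitive_root_of_unity (p * q) g"
    and roots: "u1 ^ q = 1" "u2 ^ q = 1" "v1 ^ p = 1" "v2 ^ p = 1"
    and ne: "u1 \<noteq> 1" "u2 \<noteq> 1" "u1 \<noteq> u2" "v2 \<noteq> 1"
    and collision: "(1 - u1) * (1 - v2) = (1 - u2) * (1 - v1)"
  shows "\<exists>P. decoding_polynomial t g (canonical_set p q) P \<and> num_monomials P = 3"
proof -
  \<comment> \<open>Chosen so that the determinant times \<open>u1 * v1\<close> becomes
    \<open>u2 * v2\<close> times the difference of the two sides of
    \<open>collision\<close>.\<close>
  define u v w z where "u = u2" and "v = u2 / u1" and "w = v2" and "z = v2 / v1"
  have pos: "p > 0" "q > 0" using pq by (auto simp: prime_gt_0_nat)
  have nz: "u1 \<noteq> 0" "u2 \<noteq> 0" "v1 \<noteq> 0" "v2 \<noteq> 0"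
    using roots pos by (auto simp: power_0_left)
  have uv: "u ^ q = 1" "v ^ q = 1" and wz: "w ^ p = 1" "z ^ p = 1"
    using roots by (simp_all add: u_def v_def w_def z_def power_divide)
  note unique = roots_of_unity_decompose_unique[OF pq]
  have uv_ne: "u \<noteq> 1" "v \<noteq> 1" "u \<noteq> v" "w \<noteq> 1"
    using ne nz by (auto simp: u_def v_def w_def field_simps)
  \<comment> \<open>The \<open>p\<close>-th and \<open>q\<close>-th roots of unity share only 1, so
    none of the three coefficients vanishes and the polynomial has exactly three monomials.\<close>
  have "v \<noteq> z" using unique(1)[of v 1 1 z] uv wz uv_ne by auto
  have "u \<noteq> w" using unique(1)[of u 1 1 w] uv wz uv_ne by auto
  have "u * z \<noteq> v * w" using unique(1)[of u v z w] uv wz uv_ne by auto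
  have det: "(u * z - v * w) + (v - z) * (u * w) + (w - u) * (v * z) = 0"
  proof -
    have "((u * z - v * w) + (v - z) * (u * w) + (w - u) * (v * z)) * (u1 * v1) =
      u2 * v2 * ((1 - u2) * (1 - v1) - (1 - u1) * (1 - v2))"
      using nz by (simp add: u_def v_def w_def z_def field_simps)
    then show ?thesis using collision nz by simp
  qed
  define s where "s = (u * z - v * w) + (v - z) + (w - u)"
  have "s \<noteq> 0"
    unfolding s_def using uv_ne \<open>v \<noteq> z\<close> \<open>u \<noteq> w\<close> det by (intro collinear_kernel_sum_nonzero) auto
  have exp: "\<exists>i<p * q. g ^ i = x * y" if "x ^ q = 1" "y ^ p = 1" for x y :: "bit alg_closure"
  proof -
    have "(x * y) ^ (p * q) = (x ^ q) ^ p * (y ^ p) ^ q"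
      by (simp add: power_mult_distrib mult.commute flip: power_mult)
    then have "x * y \<in> {x. x ^ (p * q) = 1}" using that by simp
    also have "\<dots> = (\<lambda>i. g ^ i) ` {..<p * q}"
      using bij_betw_power_primitive_root[OF g] pos by (simp add: bij_betw_def)
    finally show ?thesis by auto
  qed
  obtain i j where ij: "g ^ i = u * w" "g ^ j = v * z" using exp uv wz by metis
  have "i \<noteq> j" using ij unique(1)[of u v w z] uv wz uv_ne by auto
  have "i \<noteq> 0" using ij unique(1)[of u 1 w 1] uv wz uv_ne by (cases i) auto
  have "j \<noteq> 0" using ij unique(1)[of v 1 z 1] uv wz uv_ne by (cases j) auto
  define P where "P = monom ((u * z - v * w) / s) 0 + monom ((v - z) / s) i + monom ((w - u) / s) j"
  have coeff: "coeff P n = (if n = 0 then (u * z - v * w) / s else if n = i then (v - z) / s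
      else if n = j then (w - u) / s else 0)" for n
    using \<open>i \<noteq> j\<close> \<open>i \<noteq> 0\<close> \<open>j \<noteq> 0\<close> by (simp add: P_def)
  have "{n. coeff P n \<noteq> 0} = {0, i, j}"
    using \<open>s \<noteq> 0\<close> \<open>v \<noteq> z\<close> \<open>u \<noteq> w\<close> \<open>u * z \<noteq> v * w\<close> by (auto simp: coeff)
  then have "num_monomials P = 3"
    using \<open>i \<noteq> j\<close> \<open>i \<noteq> 0\<close> \<open>j \<noteq> 0\<close> by (simp add: num_monomials_def)
  moreover have "coeff P n \<in> GF2 t" for n
  proof -
    have GF: "x \<in> GF2 t" if "x ^ (p * q) = 1" for x using GF2_iff[OF m] that by blast
    have "u \<in> GF2 t" "v \<in> GF2 t" "w \<in> GF2 t" "z \<in> GF2 t"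
      using uv wz GF by (metis power_mult mult.commute power_one)+
    moreover have "x - y \<in> GF2 t" if "x \<in> GF2 t" "y \<in> GF2 t" for x y
      using that by (simp add: GF2_add GF2_uminus flip: add_uminus_conv_diff)
    ultimately show ?thesis
      unfolding coeff s_def divide_inverse
      by (auto intro!: GF2_add GF2_mult GF2_inverse GF2_0)
  qed
  moreover have "poly P 1 = 1"
    using \<open>s \<noteq> 0\<close> by (simp add: P_def poly_monom s_def flip: add_divide_distrib)
  moreover have "poly P (g ^ r) = 0" if "r \<in> canonical_set p q" for r
  proof -
    have eval: "poly P (g ^ r) = ((u * z - v * w) + (v - z) * (u * w) ^ r + (w - u) * (v * z) ^ r) / s"
      by (simp add: P_def poly_monom add_divide_distrib mult.commute[of r] power_mult flip: ij power_mult)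
    have pow: "x ^ r = x ^ r'" if "x ^ n = 1" "[r = r'] (mod n)" for x :: "bit alg_closure" and n r'
    proof -
      have "x ^ k = x ^ (k mod n)" for k
        by (metis mult_1_left that(1) mult_div_mod_eq power_add power_mult power_one)
      then show ?thesis using that(2) by (metis cong_def)
    qed
    from that consider "r = 1" | "[r = 0] (mod p)" "[r = 1] (mod q)" | "[r = 1] (mod p)" "[r = 0] (mod q)"
      using crt_residue_1_1[OF pq] crt_residue[OF pq, of 0 1] crt_residue[OF pq, of 1 0]
      by (auto simp: canonical_set_def)
    then show ?thesis
    proof cases
      case 1
      then show ?thesis using eval det by simp
    next
      case 2
      then have "u ^ r = u" "v ^ r = v" "w ^ r = 1" "z ^ r = 1"
        using pow[OF uv(1) 2(2)] pow[OF uv(2) 2(2)] pow[OF wz(1) 2(1)] pow[OF wz(2) 2(1)] by simp_all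
      then show ?thesis by (simp add: eval power_mult_distrib algebra_simps)
    next
      case 3
      then have "u ^ r = 1" "v ^ r = 1" "w ^ r = w" "z ^ r = z"
        using pow[OF uv(1) 3(2)] pow[OF uv(2) 3(2)] pow[OF wz(1) 3(1)] pow[OF wz(2) 3(1)] by simp_all
      then show ?thesis by (simp add: eval power_mult_distrib algebra_simps)
    qed
  qed
  ultimately show ?thesis by (auto simp: decoding_polynomial_def)
qed

subsection \<open>Roots of unity shifted by one\<close>

text \<open>Including 1 brings the size to \<open>n\<close>, as needed for a factorization by
  counting.\<close>

definition shifted_roots :: "nat \<Rightarrow> bit alg_closure set" where
  "shifted_roots n = insert 1 ((\<lambda>x. 1 - x) ` ({x. x ^ n = 1} - {1}))"

text \<open>The element 1 fits the pattern of ratios because \<open>1 - v ^ 2 = (1 - v) ^ 2\<close>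
  in characteristic 2: \<open>1 - v\<close> is then itself the ratio of \<open>1 - v ^ 2\<close> to
  \<open>1 - v\<close>.\<close>

lemma shifted_roots_ratio:
  assumes "odd n" "x \<in> shifted_roots n" "y \<in> shifted_roots n" "x \<noteq> y"
  obtains v w where "v ^ n = 1" "w ^ n = 1" "v \<noteq> 1" "w \<noteq> 1" "v \<noteq> w"
    "x * (1 - w) = y * (1 - v)"
proof -
  have square: "(v ^ 2) ^ n = 1" "v ^ 2 \<noteq> 1" "v ^ 2 \<noteq> v" "1 - v ^ 2 = (1 - v) * (1 - v)"
    if v: "v ^ n = 1" "v \<noteq> 1" for v :: "bit alg_closure"
  proof -
    show "(v ^ 2) ^ n = 1" using v by (metis power_mult mult.commute power_one)
    have "(1 - v) * (1 - v) = 1 + v ^ 2 - 2 * v" by (simp add: algebra_simps power2_eq_square)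
    also have "\<dots> = 1 + v ^ 2"
      using of_nat_CHAR[where 'a = "bit alg_closure"]
      by (simp only: CHAR_bit_alg_closure of_nat_numeral mult_zero_left diff_zero)
    finally show *: "1 - v ^ 2 = (1 - v) * (1 - v)"
      using minus_CHAR_2[of 1 "v ^ 2"] CHAR_bit_alg_closure by metis
    then show "v ^ 2 \<noteq> 1" using v by auto
    have "v \<noteq> 0" using v assms(1) by (auto simp: power_0_left split: if_splits)
    then show "v ^ 2 \<noteq> v" using v by (simp add: power2_eq_square)
  qed
  from assms consider v where "x = 1 - v" "v ^ n = 1" "v \<noteq> 1" "y = 1"
    | w where "x = 1" "y = 1 - w" "w ^ n = 1" "w \<noteq> 1"
    | v w where "x = 1 - v" "v ^ n = 1" "v \<noteq> 1" "y = 1 - w" "w ^ n = 1" "w \<noteq> 1"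
    by (auto simp: shifted_roots_def)
  then show ?thesis
  proof cases
    case (1 v)
    then show ?thesis using square[of v] by (intro that[of "v ^ 2" v]) auto
  next
    case (2 w)
    then show ?thesis using square[of w] by (intro that[of w "w ^ 2"]) auto
  next
    case (3 v w)
    then show ?thesis using assms by (intro that[of v w]) auto
  qed
qed

lemma card_shifted_roots:
  fixes g :: "bit alg_closure"
  assumes "primitive_root_of_unity n g" "n > 0"
  shows "card (shifted_roots n) = n"
proof -
  have bij: "bij_betw (\<lambda>i. g ^ i) {..<n} {x :: bit alg_closure. x ^ n = 1}"
    by (rule bij_betw_power_primitive_root[OF assms])
  then have fin: "finite {x :: bit alg_closure. x ^ n = 1}" using bij_betw_finite by blast
  have "1 \<notin> (\<lambda>x. 1 - x) ` ({x :: bit alg_closure. x ^ n = 1} - {1})"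
    using assms(2) by (auto simp: power_0_left)
  then have "card (shifted_roots n) = Suc (card ({x :: bit alg_closure. x ^ n = 1} - {1}))"
    using fin by (simp add: shifted_roots_def card_image inj_on_def)
  also have "\<dots> = card {x :: bit alg_closure. x ^ n = 1}"
    using fin by (intro card_Suc_Diff1) auto
  finally show ?thesis using bij_betw_same_card[OF bij] by simp
qed

lemma shifted_roots_nonzero: "x \<in> shifted_roots n \<Longrightarrow> x \<noteq> 0"
  by (auto simp: shifted_roots_def)

lemma shifted_roots_not_subset_roots:
  fixes g :: "bit alg_closure"
  assumes t: "prime t" and p: "prime p" and m: "p * q = 2 ^ t - 1" and q: "q > 1"
    and g: "primitive_root_of_unity p g"
  shows "\<not> shifted_roots p \<subseteq> {x. x ^ p = 1}"
proof
  assume sub: "shifted_roots p \<subseteq> {x. x ^ p = 1}"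
  \<comment> \<open>\<open>H\<close> is then a proper subfield of \<open>GF2 t\<close>, impossible for prime \<open>t\<close>; only Lagrange for the
    additive group is needed.\<close>
  define H :: "bit alg_closure set" where "H = insert 0 {x. x ^ p = 1}"
  define G where "G = \<lparr>carrier = GF2 t, monoid.mult = (+), one = (0 :: bit alg_closure)\<rparr>"
  have p0: "p > 0" and p1: "p > 1" using p prime_gt_0_nat prime_gt_1_nat by blast+
  have diff: "x - y = x + y" for x y :: "bit alg_closure"
    by (rule minus_CHAR_2) (rule CHAR_bit_alg_closure)
  have H_add: "x + y \<in> H" if "x \<in> H" "y \<in> H" for x y
  \<comment> \<open>For distinct nonzero \<open>x\<close> and \<open>y\<close> the sum is
    \<open>x\<close> times the shifted root \<open>1 - y / x\<close>, a \<open>p\<close>-th root of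
    unity by assumption.\<close>
  proof (cases "x = 0 \<or> y = 0 \<or> x = y")
    case True
    then show ?thesis using that diff[of x x] by (auto simp: H_def)
  next
    case False
    have "(y / x) ^ p = 1" using that False by (auto simp: H_def power_divide)
    moreover have "y / x \<noteq> 1" using False by auto
    ultimately have "1 - y / x \<in> shifted_roots p" by (auto simp: shifted_roots_def)
    then have "(1 - y / x) ^ p = 1" using sub by auto
    moreover have "x + y = x * (1 - y / x)" using False by (simp add: diff field_simps)
    ultimately show ?thesis using that False by (simp add: H_def power_mult_distrib)
  qed
  have "H \<subseteq> GF2 t"
  proof
    fix x assume "x \<in> H"
    then have "x = 0 \<or> x ^ (p * q) = 1" by (auto simp: H_def power_mult)
    then show "x \<in> GF2 t" by (simp add: GF2_iff[OF m])
  qed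
  have "group G"
    by (rule groupI) (auto simp: G_def GF2_add GF2_0 add.assoc intro!: bexI[of _ "- x" for x] GF2_uminus)
  have inv: "inv\<^bsub>G\<^esub> x = x" if "x \<in> carrier G" for x
    using that diff[of x x] by (intro group.inv_equality[OF \<open>group G\<close>]) (auto simp: G_def)
  have "subgroup H G"
  proof (rule group.subgroupI[OF \<open>group G\<close>])
    show "H \<subseteq> carrier G" using \<open>H \<subseteq> GF2 t\<close> by (simp add: G_def)
    then show "inv\<^bsub>G\<^esub> x \<in> H" if "x \<in> H" for x using that inv[of x] by auto
    show "x \<otimes>\<^bsub>G\<^esub> y \<in> H" if "x \<in> H" "y \<in> H" for x y
      using that H_add by (simp add: G_def)
  qed (auto simp: H_def)
  then have "card (rcosets\<^bsub>G\<^esub> H) * card H = Coset.order G" by (rule group.lagrange[OF \<open>group G\<close>])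
  moreover have "card H = p + 1"
  proof -
    have bij: "bij_betw (\<lambda>i. g ^ i) {..<p} {x :: bit alg_closure. x ^ p = 1}"
      by (rule bij_betw_power_primitive_root[OF g p0])
    then have "finite {x :: bit alg_closure. x ^ p = 1}"
      using bij_betw_finite by blast
    then show ?thesis using bij_betw_same_card[OF bij] p0 by (simp add: H_def power_0_left)
  qed
  moreover have "Coset.order G = 2 ^ t"
    using card_GF2[of t] t by (simp add: Coset.order_def G_def prime_gt_0_nat)
  \<comment> \<open>So \<open>p = 2 ^ a - 1\<close>, and the order of 2 mod \<open>p\<close> divides
    both \<open>a\<close> and the prime \<open>t\<close>. Not being 1, it is \<open>t\<close>,
    whence \<open>2 ^ t \<le> p + 1\<close>, contrary to \<open>q > 1\<close>.\<close>
  ultimately have "p + 1 dvd 2 ^ t" by (metis dvd_triv_right)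
  then obtain a where a: "p + 1 = 2 ^ a" using divides_primepow_nat[of 2 "p + 1" t] by auto
  then have "p = 2 ^ a - 1" by simp
  then have "[2 ^ a = 1] (mod p)" by (simp add: cong_altdef_nat)
  moreover have "[2 ^ t = 1] (mod p)"
    unfolding cong_altdef_nat[OF one_le_power[OF one_le_numeral]] m[symmetric] by simp
  ultimately have "ord p 2 dvd a" "ord p 2 dvd t" by (simp_all only: ord_divides)
  moreover have "ord p 2 \<noteq> 1"
  proof
    assume "ord p 2 = 1"
    then have "[2 ^ 1 = 1] (mod p)" by (simp only: ord_divides) simp
    then show False using p1 by (simp add: cong_altdef_nat)
  qed
  ultimately have "t dvd a" using t by (metis prime_nat_iff)
  moreover have "a > 0" using a p0 by (cases a) auto
  ultimately have "(2 :: nat) ^ t \<le> 2 ^ a" by (simp add: dvd_imp_le)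
  then have "2 ^ t - 1 \<le> p" unfolding a[symmetric] by simp
  then have "p * q \<le> p" by (simp only: m)
  then show False using p0 q by simp
qed

text \<open>Discrete logarithms to base \<open>g\<close> carry sets of field elements over to sets
  of residues mod \<open>n\<close>.\<close>

lemma card_exponents:
  assumes "primitive_root_of_unity n g" "n > 0" "S \<subseteq> {x. x ^ n = 1}"
  shows "card {i. i < n \<and> g ^ i \<in> S} = card S"
proof -
  have bij: "bij_betw (\<lambda>i. g ^ i) {..<n} {x. x ^ n = 1}"
    by (rule bij_betw_power_primitive_root[OF assms(1,2)])
  have "(\<lambda>i. g ^ i) ` {i. i < n \<and> g ^ i \<in> S} = S"
  proof
    show "S \<subseteq> (\<lambda>i. g ^ i) ` {i. i < n \<and> g ^ i \<in> S}"
    proof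
      fix x assume "x \<in> S"
      then have "x \<in> (\<lambda>i. g ^ i) ` {..<n}" using assms(3) bij by (auto simp: bij_betw_def)
      then show "x \<in> (\<lambda>i. g ^ i) ` {i. i < n \<and> g ^ i \<in> S}" using \<open>x \<in> S\<close> by auto
    qed
  qed auto
  moreover have "inj_on (\<lambda>i. g ^ i) {i. i < n \<and> g ^ i \<in> S}"
    using bij by (auto simp: bij_betw_def intro: inj_on_subset)
  ultimately show ?thesis using card_image by metis
qed

lemma shifted_roots_subset:
  assumes "n = 2 ^ t - 1" "k dvd n"
  shows "shifted_roots k \<subseteq> {x. x ^ n = 1}"
proof
  fix x assume x: "x \<in> shifted_roots k"
  have GF: "y \<in> GF2 t" if "y ^ k = 1" for y
    using that assms by (auto simp: GF2_iff[OF assms(1)] power_mult elim!: dvdE)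
  have "1 - y \<in> GF2 t" if "y ^ k = 1" for y
    using GF2_add[OF GF2_1 GF2_uminus[OF GF[OF that]]] by simp
  then have "x \<in> GF2 t" using x by (auto simp: shifted_roots_def GF2_1)
  then show "x \<in> {x. x ^ n = 1}"
    using GF2_iff[OF assms(1)] shifted_roots_nonzero[OF x] by auto
qed

text \<open>Since \<open>1 = g ^ 0\<close> is a shifted root, all exponents in question are
  congruent to 0 mod \<open>l\<close>, and \<open>g ^ i\<close> with \<open>l\<close> dividing
  \<open>i\<close> is a \<open>k\<close>-th root of unity.\<close>

lemma shifted_roots_subset_roots:
  assumes g: "primitive_root_of_unity (k * l) g" and pos: "k > 0" "l > 0"
    and sub: "shifted_roots k \<subseteq> {x. x ^ (k * l) = 1}"
    and cong: "\<And>i j. i < k * l \<Longrightarrow> j < k * l \<Longrightarrow> g ^ i \<in> shifted_roots k \<Longrightarrow>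
      g ^ j \<in> shifted_roots k \<Longrightarrow> [i = j] (mod l)"
  shows "shifted_roots k \<subseteq> {x. x ^ k = 1}"
proof
  fix x assume x: "x \<in> shifted_roots k"
  have "k * l > 0" using pos by simp
  then have "x \<in> (\<lambda>i. g ^ i) ` {..<k * l}"
    using x sub bij_betw_power_primitive_root[OF g] by (auto simp: bij_betw_def)
  then obtain i where i: "i < k * l" "x = g ^ i" by auto
  then have "[i = 0] (mod l)"
    using cong[of i 0] x \<open>k * l > 0\<close> by (simp add: shifted_roots_def)
  then have "k * l dvd i * k" by (simp add: cong_0_iff mult.commute)
  then show "x \<in> {x. x ^ k = 1}"
    using primitive_root_power_eq_1_iff[OF g \<open>k * l > 0\<close>] i by (simp flip: power_mult)
qed

theorem theorem3p3:
  fixes t p q m :: nat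
  assumes "prime t" and "prime p" and "prime q"
    and "m = 2 ^ t - 1" and "m = p * q"
  shows "m \<in> M2"
proof -
  note t = assms(1) and p = assms(2) and q = assms(3)
  have pq_m: "p * q = 2 ^ t - 1" using assms(4,5) by simp
  have pos: "p > 0" "q > 0" "m > 0" and gt1: "p > 1" "q > 1"
    using p q prime_gt_0_nat prime_gt_1_nat by (auto simp: assms(5))
  have t2: "t \<ge> 2" using t by (rule prime_ge_2_nat)
  have Suc_m: "p * q + 1 = 2 ^ t" using pq_m by simp
  have "even (p * q + 1)" using t2 by (simp only: Suc_m even_power) simp
  then have odd: "odd p" "odd q" by simp_all
  have "p \<noteq> q"
  proof
    \<comment> \<open>An odd square plus 1 is 2 mod 4, whereas 4 divides
      \<open>2 ^ t\<close>.\<close>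
    assume "p = q"
    obtain k where k: "p = 2 * k + 1" using odd(1) by (rule oddE)
    have "4 dvd (2 :: nat) ^ t" using le_imp_power_dvd[OF t2, of "2 :: nat"] by simp
    then have "4 dvd p * p + 1" using Suc_m \<open>p = q\<close> by simp
    also have "p * p + 1 = 4 * (k * k + k) + 2" by (simp add: k algebra_simps)
    finally have "(4 :: nat) dvd 2"
      using dvd_add_right_iff[OF dvd_triv_left[of 4 "k * k + k"], of 2] by blast
    then show False by simp
  qed
  note pq = p q this
  have "ord m 2 = t"
  proof -
    have "[2 ^ t = 1] (mod m)" using assms(4) by (simp add: cong_altdef_nat)
    then have "ord m 2 dvd t" by (simp only: ord_divides)
    moreover have "ord m 2 \<noteq> 1"
    proof
      assume "ord m 2 = 1"
      then have "[2 ^ 1 = 1] (mod m)" by (simp only: ord_divides) simp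
      then have "m = 1" by (simp add: cong_altdef_nat)
      then show False using assms(5) gt1 by simp
    qed
    ultimately show ?thesis using t by (metis prime_nat_iff)
  qed
  have "\<exists>P. decoding_polynomial t g (canonical_set p q) P \<and> num_monomials P = 3"
    if g: "primitive_root_of_unity m g" for g
  proof (rule ccontr)
    assume no_P: "\<not> ?thesis"
    have g': "primitive_root_of_unity (p * q) g" "primitive_root_of_unity (q * p) g"
      using g by (simp_all add: assms(5) mult.commute)
    have gp: "primitive_root_of_unity p (g ^ q)" and gq: "primitive_root_of_unity q (g ^ p)"
      using g' pos by (auto intro: primitive_root_of_unity_power)
    \<comment> \<open>Logarithms to base \<open>h\<close> make \<open>B\<close> the exponents of the
      inverses of the shifted \<open>q\<close>-th roots, so \<open>a + b\<close> stands for a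
      quotient \<open>x / y\<close> of shifted roots.\<close>
    define h where "h = inverse g"
    have h: "primitive_root_of_unity m h"
      using g by (simp add: h_def primitive_root_of_unity_def power_inverse)
    have "g \<noteq> 0" using g pos by (auto simp: primitive_root_of_unity_def power_0_left)
    then have gh: "g ^ i * h ^ i = 1" for i by (simp add: h_def flip: power_mult_distrib)
    have eq_iff: "g ^ i = g ^ j \<longleftrightarrow> i mod m = j mod m" for i j
      using primitive_root_power_eq_iff[OF g pos(3)] by (simp add: cong_def)
    define A where "A = {i. i < m \<and> g ^ i \<in> shifted_roots p}"
    define B where "B = {i. i < m \<and> h ^ i \<in> shifted_roots q}"
    have sub: "shifted_roots p \<subseteq> {x. x ^ m = 1}" "shifted_roots q \<subseteq> {x. x ^ m = 1}"
      by (rule shifted_roots_subset[OF assms(4)], simp add: assms(5))+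
    have card: "card A = p" "card B = q"
      using card_exponents[OF g pos(3) sub(1)] card_exponents[OF h pos(3) sub(2)]
        card_shifted_roots[OF gp pos(1)] card_shifted_roots[OF gq pos(2)]
      by (simp_all add: A_def B_def)
    have inj: "inj_on (\<lambda>(a, b). (a + b) mod m) (A \<times> B)"
    proof (rule inj_onI, clarify)
      fix a b a' b' assume ab: "a \<in> A" "b \<in> B" "a' \<in> A" "b' \<in> B"
        and "(a + b) mod m = (a' + b') mod m"
      then have eq: "g ^ a * g ^ b = g ^ a' * g ^ b'" by (simp add: eq_iff flip: power_add)
      define x x' y y' where "x = g ^ a" and "x' = g ^ a'" and "y = h ^ b" and "y' = h ^ b'"
      have mem: "x \<in> shifted_roots p" "x' \<in> shifted_roots p" "y \<in> shifted_roots q" "y' \<in> shifted_roots q"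
        using ab by (simp_all add: A_def B_def x_def x'_def y_def y'_def)
      then have nz: "x \<noteq> 0" "x' \<noteq> 0" "y \<noteq> 0" "y' \<noteq> 0" using shifted_roots_nonzero by blast+
      have "x * y' = (g ^ a * g ^ b) * h ^ b * h ^ b'"
        using gh[of b] by (simp add: x_def y'_def mult.assoc)
      also have "\<dots> = x' * (g ^ b' * h ^ b') * h ^ b"
        by (simp only: eq x'_def mult_ac)
      finally have xy: "x * y' = x' * y" using gh[of b'] by (simp add: y_def)
      have "x = x'"
      proof (rule ccontr)
        assume "x \<noteq> x'"
        then have "y \<noteq> y'" using xy nz by auto
        obtain v w where vw: "v ^ p = 1" "w ^ p = 1" "v \<noteq> 1" "w \<noteq> 1" "v \<noteq> w"
          "x * (1 - w) = x' * (1 - v)"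
          using shifted_roots_ratio[OF odd(1) mem(1,2) \<open>x \<noteq> x'\<close>] .
        obtain u u' where uu: "u ^ q = 1" "u' ^ q = 1" "u \<noteq> 1" "u' \<noteq> 1" "u \<noteq> u'"
          "y * (1 - u') = y' * (1 - u)"
          using shifted_roots_ratio[OF odd(2) mem(3,4) \<open>y \<noteq> y'\<close>] .
        \<comment> \<open>The equal ratios \<open>x / x' = y / y'\<close>, written as
          \<open>(1 - v) / (1 - w)\<close> and \<open>(1 - u) / (1 - u')\<close>, give the excluded
          collision.\<close>
        have "(x' * y) * ((1 - u) * (1 - w)) = (x * (1 - w)) * (y' * (1 - u))"
          by (simp flip: xy)
        also have "\<dots> = (x' * y) * ((1 - u') * (1 - v))"
          by (simp only: vw(6) flip: uu(6)) (simp only: mult_ac)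
        finally have "(1 - u) * (1 - w) = (1 - u') * (1 - v)" using nz by simp
        then show False
          using no_P collision_imp_decoding_polynomial[OF pq pq_m g'(1) uu(1,2) vw(1,2) uu(3,4,5) vw(4)]
          by blast
      qed
      then have "y = y'" using xy nz by simp
      have "a mod m = a' mod m" using \<open>x = x'\<close> by (simp add: x_def x'_def eq_iff)
      moreover have "b mod m = b' mod m"
        using \<open>y = y'\<close> primitive_root_power_eq_iff[OF h pos(3)] by (simp add: y_def y'_def cong_def)
      ultimately show "a = a' \<and> b = b'" using ab by (simp add: A_def B_def)
    qed
    \<comment> \<open>Injectivity suffices, since
      \<open>card A * card B = p * q = m\<close>.\<close>
    moreover have "(\<lambda>(a, b). (a + b) mod m) ` (A \<times> B) = {..<m}"
    proof (rule card_subset_eq)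
      show "card ((\<lambda>(a, b). (a + b) mod m) ` (A \<times> B)) = card {..<m}"
        using card_image[OF inj] by (simp add: card_cartesian_product card assms(5))
    qed (use pos in auto)
    ultimately have "factorization_mod (p * q) A B"
      by (simp add: factorization_mod_def bij_betw_def assms(5))
    from factorization_mod_prime_prime[OF this pq card]
    show False
    proof
      assume "\<forall>a\<in>A. \<forall>a'\<in>A. [a = a'] (mod q)"
      then have "shifted_roots p \<subseteq> {x. x ^ p = 1}"
        using sub(1) pos by (intro shifted_roots_subset_roots[OF g'(1)]) (auto simp: A_def assms(5))
      then show False using shifted_roots_not_subset_roots[OF t p pq_m gt1(2) gp] by blast
    next
      assume "\<forall>b\<in>B. \<forall>b'\<in>B. [b = b'] (mod p)"
      \<comment> \<open>The exponents in \<open>B\<close> refer to \<open>h\<close>, so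
        \<open>h\<close> replaces \<open>g\<close> with the primes exchanged.\<close>
      moreover have "primitive_root_of_unity (q * p) h" using h by (simp add: assms(5) mult.commute)
      ultimately have "shifted_roots q \<subseteq> {x. x ^ q = 1}"
        using sub(2) pos
        by (intro shifted_roots_subset_roots[of q p h]) (auto simp: B_def assms(5) mult.commute)
      moreover have "q * p = 2 ^ t - 1" using pq_m by (simp add: mult.commute)
      ultimately show False using shifted_roots_not_subset_roots[OF t q _ gt1(1) gq] by blast
    qed
  qed
  then show ?thesis
    unfolding M2_def using pq odd assms(5) \<open>ord m 2 = t\<close> by auto
qed

end
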